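(* $\alpha(11,2)=931$. More precisely, there exists an independent set of cardinality $931$ in the simple graph underlying $B(11,2)$ that contains the word $0^{11}$ and does not contain the word $1^{11}$.
   Context: The de Bruijn digraph $B(k,2)$ has vertex set $\{0,1\}^k$ and edges $x_1\dots x_k\to x_2\dots x_k y$, $y\in\{0,1\}$. In its underlying simple graph (loops deleted), distinct words $x_1\dots x_k$, $y_1\dots y_k$ are adjacent iff $x_2\dots x_k=y_1\dots y_{k-1}$ or $y_2\dots y_k=x_1\dots x_{k-1}$. $\alpha(k,2)$ is the independence number of this simple graph. *)

theory Defs
  imports "Graph_Theory.Graph_Theory"
begin

definition words :: "nat \<Rightarrow> nat \<Rightarrow> nat list set" where
  "words k d = {w. set w \<subseteq> {..<d} \<and> length w = k}"

definition de_Bruijn :: "nat \<Rightarrow> nat \<Rightarrow> nat list pair_pre_digraph" where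
  "de_Bruijn k d =
     \<lparr> pverts = words k d,
       parcs = {(x # w, w @ [y]) | x w y. x # w \<in> words k d \<and> y < d} \<rparr>"

text \<open>As usual in this library, an undirected graph is a symmetric digraph.\<close>

definition underlying_simple_graph :: "'a pair_pre_digraph \<Rightarrow> 'a pair_pre_digraph" where
  "underlying_simple_graph G =
     \<lparr> pverts = pverts G, parcs = parcs (mk_symmetric (with_proj G)) - Id \<rparr>"

definition independent_set :: "'a pair_pre_digraph \<Rightarrow> 'a set \<Rightarrow> bool" where
  "independent_set G S \<longleftrightarrow> S \<subseteq> pverts G \<and> (\<forall>u\<in>S. \<forall>v\<in>S. (u, v) \<notin> parcs G)"

text \<open>Meaningful for finite graphs only, where the maximum exists.\<close>

definition independence_number :: "'a pair_pre_digraph \<Rightarrow> nat" where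
  "independence_number G = Max (card ` {S. independent_set G S})"

definition de_Bruijn_alpha :: "nat \<Rightarrow> nat \<Rightarrow> nat" where
  "de_Bruijn_alpha k d = independence_number (underlying_simple_graph (de_Bruijn k d))"

lemma finite_words: "finite (words k d)"
  unfolding words_def by (rule finite_lists_length_eq) simp

lemma pair_graph_underlying_simple_graph_de_Bruijn: "pair_graph (underlying_simple_graph (de_Bruijn k d))"
proof -
  let ?G = "underlying_simple_graph (de_Bruijn k d)"
  have wf: "parcs ?G \<subseteq> words k d \<times> words k d"
    by (auto simp: underlying_simple_graph_def de_Bruijn_def mk_symmetric_def words_def)
  moreover have fin: "finite (parcs ?G)"
    by (rule finite_subset[OF wf]) (simp add: finite_words)
  moreover have "pverts ?G = words k d"
    by (simp add: underlying_simple_graph_def de_Bruijn_def)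
  moreover have "sym (parcs ?G)"
    using symmetric_mk_symmetric[of "with_proj (de_Bruijn k d)"]
    by (auto simp: underlying_simple_graph_def symmetric_def intro!: symI dest: symD)
  moreover have "irrefl (parcs ?G)"
    by (auto simp: underlying_simple_graph_def irrefl_def)
  ultimately show ?thesis
    by unfold_locales (auto simp: finite_words symmetric_def irrefl_def arcs_ends_def arc_to_ends_def)
qed

lemma de_Bruijn_adj_iff:
  assumes "u \<in> words k d" "v \<in> words k d" "k > 0"
  shows "(u, v) \<in> parcs (underlying_simple_graph (de_Bruijn k d)) \<longleftrightarrow>
           u \<noteq> v \<and> (tl u = butlast v \<or> tl v = butlast u)"
proof -
  have *: "(a, b) \<in> parcs (de_Bruijn k d) \<longleftrightarrow> tl a = butlast b"
    if a: "a \<in> words k d" and b: "b \<in> words k d" for a b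
  proof
    assume t: "tl a = butlast b"
    have ne: "a \<noteq> []" "b \<noteq> []" using a b assms(3) by (auto simp: words_def)
    have 1: "a = hd a # tl a" using ne(1) by (rule list.collapse[symmetric])
    have 2: "b = tl a @ [last b]" using append_butlast_last_id[OF ne(2)] t by argo
    have 3: "last b < d" using last_in_set[OF ne(2)] b by (auto simp: words_def)
    have "hd a # tl a \<in> words k d" using a 1 by argo
    with 3 have "(hd a # tl a, tl a @ [last b]) \<in> parcs (de_Bruijn k d)"
      unfolding de_Bruijn_def by auto
    then show "(a, b) \<in> parcs (de_Bruijn k d)"
      by (simp only: 1[symmetric] 2[symmetric])
  qed (auto simp: de_Bruijn_def)
  have "(u, v) \<in> parcs (underlying_simple_graph (de_Bruijn k d)) \<longleftrightarrow>
          u \<noteq> v \<and> ((u, v) \<in> parcs (de_Bruijn k d) \<or> (v, u) \<in> parcs (de_Bruijn k d))"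
    unfolding underlying_simple_graph_def mk_symmetric_def
    by (cases "u = v") (simp_all, metis fst_conv snd_conv surjective_pairing)
  then show ?thesis
    using *[OF assms(1,2)] *[OF assms(2,1)] by simp
qed

end

theory Submission
  imports Defs
begin

text \<open>Rotation splits the words of length 11 into 186 cycles of length 11, each of which meets an
  independent set in at most 5 words, and two fixed words; this only gives the bound 932. The two
  fixed words and ten suitable rotation cycles, 112 words in all, can however be repartitioned into
  ten odd cycles and eleven edges, so that they contribute at most 51 words instead of 52. The
  independent set for the lower bound was found by a SAT solver, asking for exactly 5 words of each
  rotation cycle and for few maximal intervals in the numerical encoding.\<close>

section \<open>Binary words as numbers\<close>

text \<open>The first letter is the least significant bit, so that an arc of the de Bruijn digraph
  drops the least significant bit and adds a most significant one.\<close>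

definition code :: "nat list \<Rightarrow> nat" where
  "code w = horner_sum id 2 w"

lemma code_simps [simp]: "code [] = 0" "code (x # w) = x + 2 * code w"
  by (simp_all add: code_def)

lemma code_append: "code (v @ w) = code v + 2 ^ length v * code w"
  by (simp add: code_def horner_sum_append)

lemma code_replicate_0: "code (replicate n 0) = 0"
  by (induction n) simp_all

lemma code_replicate_1: "code (replicate n 1) = 2 ^ n - 1"
proof -
  have "Suc (code (replicate n 1)) = 2 ^ n"
    by (induction n) simp_all
  then show ?thesis by simp
qed

lemma words_0 [simp]: "words 0 d = {[]}"
  by (auto simp: words_def)

lemma Cons_in_words_iff [simp]: "x # w \<in> words (Suc k) d \<longleftrightarrow> x < d \<and> w \<in> words k d"
  by (auto simp: words_def)

lemma words_SucE:
  assumes "w \<in> words (Suc k) d"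
  obtains x w' where "w = x # w'" "x < d" "w' \<in> words k d"
  using assms by (cases w) (auto simp: words_def)

lemma words_Suc_snocE:
  assumes "w \<in> words (Suc k) d"
  obtains w' x where "w = w' @ [x]" "x < d" "w' \<in> words k d"
  using assms by (cases w rule: rev_cases) (auto simp: words_def)

lemma code_less: "w \<in> words k 2 \<Longrightarrow> code w < 2 ^ k"
  by (induction k arbitrary: w) (fastforce elim!: words_SucE)+

lemma inj_on_code: "inj_on code (words k 2)"
proof (induction k)
  case (Suc k)
  show ?case
  proof (rule inj_onI)
    fix v w assume vw: "v \<in> words (Suc k) 2" "w \<in> words (Suc k) 2" "code v = code w"
    from vw(1) obtain x v' where v: "v = x # v'" "x < 2" "v' \<in> words k 2" by (rule words_SucE)
    from vw(2) obtain y w' where w: "w = y # w'" "y < 2" "w' \<in> words k 2" by (rule words_SucE)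
    have eq: "x + 2 * code v' = y + 2 * code w'"
      using vw(3) v(1) w(1) by simp
    then have "x = y" "code v' = code w'"
      using v(2) w(2) by presburger+
    then show "v = w"
      using inj_onD[OF Suc _ v(3) w(3)] v(1) w(1) by simp
  qed
qed simp

lemma bij_betw_code: "bij_betw code (words k 2) {..<2 ^ k}"
proof -
  have "code ` words k 2 \<subseteq> {..<2 ^ k}"
    by (auto dest: code_less)
  moreover have "card (words k 2) = 2 ^ k"
    using card_lists_length_eq[of "{..<2::nat}" k] by (simp add: words_def)
  ultimately have "code ` words k 2 = {..<2 ^ k}"
    by (intro card_subset_eq) (simp_all add: card_image[OF inj_on_code])
  then show ?thesis
    using inj_on_code by (simp add: bij_betw_def)
qed

lemma code_tl: "w \<in> words (Suc k) 2 \<Longrightarrow> code (tl w) = code w div 2"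
  by (auto elim!: words_SucE)

lemma code_butlast:
  assumes "w \<in> words (Suc k) 2"
  shows "code (butlast w) = code w mod 2 ^ k"
proof -
  from assms obtain v x where v: "w = v @ [x]" "v \<in> words k 2" by (rule words_Suc_snocE)
  then have "code w = code v + 2 ^ k * x"
    by (simp add: code_append words_def)
  then show ?thesis
    using v code_less[OF v(2)] by simp
qed

text \<open>Adjacency of words of length \<open>Suc k\<close>, so that length 11 means
  \<open>k = 10\<close>: on codes, \<open>div 2\<close> drops the first letter and
  \<open>mod 2 ^ k\<close> the last one.\<close>

definition adj :: "nat \<Rightarrow> nat \<Rightarrow> nat \<Rightarrow> bool" where
  "adj k u v \<longleftrightarrow> u \<noteq> v \<and> (u div 2 = v mod 2 ^ k \<or> v div 2 = u mod 2 ^ k)"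

lemma parcs_de_Bruijn_iff_adj:
  assumes "u \<in> words (Suc k) 2" "v \<in> words (Suc k) 2"
  shows "(u, v) \<in> parcs (underlying_simple_graph (de_Bruijn (Suc k) 2)) \<longleftrightarrow> adj k (code u) (code v)"
proof -
  have *: "tl a = butlast b \<longleftrightarrow> code a div 2 = code b mod 2 ^ k"
    if "a \<in> words (Suc k) 2" "b \<in> words (Suc k) 2" for a b
  proof -
    have "tl a \<in> words k 2" using that(1) by (auto elim: words_SucE)
    moreover have "butlast b \<in> words k 2" using that(2) by (auto elim: words_Suc_snocE)
    ultimately have "tl a = butlast b \<longleftrightarrow> code (tl a) = code (butlast b)"
      by (simp add: inj_on_eq_iff[OF inj_on_code])
    then show ?thesis
      using that by (simp add: code_tl code_butlast)
  qed
  have "u = v \<longleftrightarrow> code u = code v"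
    using assms by (simp add: inj_on_eq_iff[OF inj_on_code])
  then show ?thesis
    using assms by (simp add: de_Bruijn_adj_iff * adj_def)
qed

section \<open>Rotation of words as a permutation of their codes\<close>

definition rot :: "nat \<Rightarrow> nat \<Rightarrow> nat" where
  "rot k v = v div 2 + 2 ^ k * (v mod 2)"

lemma code_rotate1:
  assumes "w \<in> words (Suc k) 2"
  shows "code (rotate1 w) = rot k (code w)"
proof -
  from assms obtain x v where v: "w = x # v" "x < 2" "v \<in> words k 2" by (rule words_SucE)
  then have "code (rotate1 w) = code v + 2 ^ k * x"
    by (simp add: code_append words_def)
  moreover have "code w div 2 = code v" "code w mod 2 = x"
    using v(1,2) by simp_all
  ultimately show ?thesis
    by (simp add: rot_def)
qed

lemma rotate_in_words_iff [simp]: "rotate n w \<in> words k d \<longleftrightarrow> w \<in> words k d"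
  by (simp add: words_def)

lemma code_rotate:
  assumes "w \<in> words (Suc k) 2"
  shows "code (rotate n w) = (rot k ^^ n) (code w)"
proof (induction n)
  case (Suc n)
  then show ?case
    using code_rotate1[of "rotate n w" k] assms by simp
qed simp

text \<open>Such a number is the code of a word of length \<open>Suc k\<close>, which
  \<open>Suc k\<close> rotations restore.\<close>

lemma funpow_rot_id:
  assumes "v < 2 ^ Suc k"
  shows "(rot k ^^ Suc k) v = v"
proof -
  from assms obtain w where w: "w \<in> words (Suc k) 2" "v = code w"
    using bij_betw_imp_surj_on[OF bij_betw_code, of "Suc k"] by blast
  then have "rotate (Suc k) w = w"
    by (simp add: words_def del: rotate_Suc)
  then show ?thesis
    using code_rotate[OF w(1), of "Suc k"] w(2) by simp
qed

lemma rot_less: "v < 2 ^ Suc k \<Longrightarrow> rot k v < 2 ^ Suc k"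
  unfolding rot_def by (cases "even v") (auto simp: odd_iff_mod_2_eq_one)

lemma inj_on_rot: "inj_on (rot k) {..<2 ^ Suc k}"
proof (rule inj_on_inverseI)
  show "(rot k ^^ k) (rot k v) = v" if "v \<in> {..<2 ^ Suc k}" for v
    using funpow_rot_id[of v k] that by (simp add: funpow_swap1)
qed

text \<open>Rotation appends the letter that it drops, so it follows an arc of the de Bruijn
  digraph; at a fixed word this arc is a loop.\<close>

lemma adj_rot:
  assumes "rot k v \<noteq> v" "v < 2 ^ Suc k"
  shows "adj k v (rot k v)"
proof -
  have "v div 2 < 2 ^ k" using assms(2) by simp
  then have "rot k v mod 2 ^ k = v div 2" by (simp add: rot_def)
  then show ?thesis using assms(1) by (simp add: adj_def)
qed

section \<open>Independent sets and closed walks\<close>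

text \<open>Double counting: each step of the walk has at most one end in \<open>T\<close>, while
  each visit to \<open>T\<close> is an end of two steps because the walk closes up. Visits count
  with multiplicity.\<close>

lemma sum_closed_walk_le:
  fixes g :: "nat \<Rightarrow> 'a"
  assumes "g n = g 0" and "\<And>i. i < n \<Longrightarrow> \<not> (g i \<in> T \<and> g (Suc i) \<in> T)"
  shows "(\<Sum>i<n. of_bool (g i \<in> T)) \<le> n div 2"
proof -
  let ?a = "\<lambda>i. of_bool (g i \<in> T) :: nat"
  have "(\<Sum>i<n. ?a (Suc i)) = (\<Sum>i<n. ?a i)"
    using sum.lessThan_Suc_shift[of ?a n] assms(1) by simp
  then have "2 * (\<Sum>i<n. ?a i) = (\<Sum>i<n. ?a i + ?a (Suc i))"
    by (simp add: sum.distrib)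
  also have "\<dots> \<le> (\<Sum>i<n. 1)"
    using assms(2) by (intro sum_mono) auto
  finally show ?thesis by simp
qed

text \<open>The relation between \<open>xs\<close> and \<open>rotate1 xs\<close> expresses that
  \<open>xs\<close>, read cyclically, is a closed walk.\<close>

lemma card_Int_cycle_le:
  assumes "list_all2 E xs (rotate1 xs)" and "\<And>u v. u \<in> T \<Longrightarrow> v \<in> T \<Longrightarrow> \<not> E u v"
  shows "card (T \<inter> set xs) \<le> length xs div 2"
proof -
  let ?n = "length xs"
  define g where "g i = xs ! (i mod ?n)" for i
  have "T \<inter> set xs \<subseteq> g ` {i \<in> {..<?n}. g i \<in> T}"
    by (force simp: g_def in_set_conv_nth)
  then have "card (T \<inter> set xs) \<le> card {i \<in> {..<?n}. g i \<in> T}"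
    by (rule surj_card_le[rotated]) simp
  also have "\<dots> = (\<Sum>i<?n. of_bool (g i \<in> T))"
    by (simp add: sum.If_cases of_bool_def Int_def)
  also have "\<dots> \<le> ?n div 2"
  proof (rule sum_closed_walk_le)
    show "\<not> (g i \<in> T \<and> g (Suc i) \<in> T)" if "i < ?n" for i
      using list_all2_nthD[OF assms(1) that] that assms(2) by (auto simp: g_def nth_rotate1)
  qed (simp add: g_def)
  finally show ?thesis .
qed

lemma card_Int_concat_le:
  assumes "\<And>xs. xs \<in> set xss \<Longrightarrow> list_all2 E xs (rotate1 xs)"
    and "\<And>u v. u \<in> T \<Longrightarrow> v \<in> T \<Longrightarrow> \<not> E u v"
  shows "card (T \<inter> set (concat xss)) \<le> (\<Sum>xs\<leftarrow>xss. length xs div 2)"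
  using assms(1)
proof (induction xss)
  case (Cons xs xss)
  have "card (T \<inter> set (concat (xs # xss))) \<le> card (T \<inter> set xs) + card (T \<inter> set (concat xss))"
    by (simp add: Int_Un_distrib card_Un_le)
  also have "\<dots> \<le> length xs div 2 + (\<Sum>xs\<leftarrow>xss. length xs div 2)"
    using Cons by (intro add_mono card_Int_cycle_le[of E] assms(2)) auto
  finally show ?case by simp
qed simp

text \<open>Averaging replaces a choice of orbit representatives: the \<open>n\<close>-step closed
  walks along \<open>f\<close> from all \<open>v \<in> U\<close> together visit each element of
  \<open>T \<inter> U\<close> exactly \<open>n\<close> times, since every \<open>f ^^ i\<close>
  permutes \<open>U\<close>, and each walk visits \<open>T\<close> at most \<open>n div 2\<close>
  times.\<close>

lemma card_Int_orbits_le: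
  assumes "bij_betw f U U" "finite U"
    and "\<And>v. v \<in> U \<Longrightarrow> (f ^^ n) v = v"
    and "\<And>v. v \<in> U \<Longrightarrow> \<not> (v \<in> T \<and> f v \<in> T)"
  shows "n * card (T \<inter> U) \<le> (n div 2) * card U"
proof -
  have bij: "bij_betw (f ^^ i) U U" for i
    using assms(1) by (rule bij_betw_funpow)
  have "(\<Sum>v\<in>U. of_bool ((f ^^ i) v \<in> T)) = card (T \<inter> U)" for i
    using sum.reindex_bij_betw[OF bij, of "\<lambda>v. of_bool (v \<in> T) :: nat" i] assms(2)
    by (simp add: of_bool_def sum.If_cases Int_def conj_commute)
  then have "n * card (T \<inter> U) = (\<Sum>i<n. \<Sum>v\<in>U. of_bool ((f ^^ i) v \<in> T))"
    by simp
  also have "\<dots> = (\<Sum>v\<in>U. \<Sum>i<n. of_bool ((f ^^ i) v \<in> T))"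
    by (rule sum.swap)
  also have "\<dots> \<le> (\<Sum>v\<in>U. n div 2)"
  proof (intro sum_mono sum_closed_walk_le)
    fix v i assume "v \<in> U"
    then have "(f ^^ i) v \<in> U" using bij[of i] by (auto dest: bij_betwE)
    then show "\<not> ((f ^^ i) v \<in> T \<and> (f ^^ Suc i) v \<in> T)" using assms(4) by simp
  qed (simp add: assms(3))
  finally show ?thesis by (simp add: mult.commute)
qed

section \<open>The upper bound\<close>

text \<open>The words covered are \<open>0\<^bsup>11\<^esup>\<close>, \<open>1\<^bsup>11\<^esup>\<close> and the rotations of \<open>0\<^bsup>11-2j\<^esup>(01)\<^bsup>j\<^esup>\<close> and of their
  complements, for \<open>1 \<le> j \<le> 5\<close>. An edge is a closed walk of length 2.\<close>

definition short_cycles :: "nat list list" where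
  "short_cycles =
    [[0, 1, 1024],
     [2047, 1023, 2046],
     [4, 8, 16, 32, 64, 128, 256, 512, 1280, 513, 1026],
     [10, 20, 40, 80, 160, 320, 641, 1282, 517, 1034, 21],
     [84, 168, 336, 673, 1346, 645, 1290, 533, 1066],
     [340, 680, 1364, 681, 1362, 677, 1354, 661, 1322, 597, 1194],
     [2043, 1021, 1534, 1791, 1919, 1983, 2015, 2031, 2039],
     [2037, 2026, 1013, 1530, 765, 1406, 1727, 1887, 1967, 2007, 2027],
     [1963, 981, 1514, 757, 1402, 701, 1374, 1711, 1879],
     [1877, 1706, 853, 1450, 725, 1386, 693, 1370, 685, 1366, 683, 1367, 1707],
     [2, 5], [42, 85], [170, 341], [640, 1344], [672, 1360], [682, 1365], [687, 1375],
     [703, 1407], [767, 1535], [1962, 2005], [2042, 2045]]"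

lemma short_cycles_closed_walks: "\<forall>xs\<in>set short_cycles. list_all2 (adj 10) xs (rotate1 xs)"
  unfolding short_cycles_def adj_def by simp

text \<open>Ten of the lists have odd length and each of them saves one half:
  \<open>(112 - 10) / 2 = 51\<close>.\<close>

lemma sum_short_cycles: "(\<Sum>xs\<leftarrow>short_cycles. length xs div 2) = 51"
  unfolding short_cycles_def by simp

lemma distinct_short_cycles: "distinct (concat short_cycles)"
  unfolding short_cycles_def by simp

lemma length_short_cycles: "length (concat short_cycles) = 112"
  unfolding short_cycles_def by simp

text \<open>Closure under rotation makes the words outside the lists a union of whole rotation
  cycles, to which the averaging bound applies.\<close>

lemma rot_short_cycles: "\<forall>v\<in>set (concat short_cycles). v < 2048 \<and> rot 10 v \<in> set (concat short_cycles)"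
  unfolding short_cycles_def rot_def by simp

lemma fixed_short_cycles: "{0, 2047} \<subseteq> set (concat short_cycles)"
  unfolding short_cycles_def by simp

lemma card_independent_le:
  assumes "T \<subseteq> {..<2048}" and indep: "\<And>u v. u \<in> T \<Longrightarrow> v \<in> T \<Longrightarrow> \<not> adj 10 u v"
  shows "card T \<le> 931"
proof -
  define X where "X = set (concat short_cycles)"
  define U where "U = {..<2048} - X"
  have X: "X \<subseteq> {..<2048}" "rot 10 ` X \<subseteq> X"
    using rot_short_cycles unfolding X_def by blast+
  have ends: "0 \<in> X" "2047 \<in> X"
    using fixed_short_cycles unfolding X_def by blast+
  have cardX: "card X = 112"
    using distinct_card[OF distinct_short_cycles] length_short_cycles by (simp add: X_def)
  then have cardU: "card U = 1936"
    using X(1) by (simp add: U_def card_Diff_subset finite_subset)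
  have inj: "inj_on (rot 10) {..<2048}"
    using inj_on_rot[of 10] by simp
  have "rot 10 ` {..<2048} = {..<2048}"
    using rot_less[of _ 10] by (intro endo_inj_surj inj) auto
  moreover have "rot 10 ` X = X"
    using X inj by (intro endo_inj_surj) (auto intro: finite_subset inj_on_subset)
  ultimately have "rot 10 ` U = U"
    using inj_on_image_set_diff[OF inj, of "{..<2048}" X] X(1) by (simp add: U_def)
  then have "bij_betw (rot 10) U U"
    using inj_on_subset[OF inj] by (simp add: bij_betw_def U_def)
  then have "11 * card (T \<inter> U) \<le> (11 div 2) * card U"
  proof (rule card_Int_orbits_le)
    fix v assume "v \<in> U"
    then have v: "v < 2048" "v \<noteq> 0" "v \<noteq> 2047"
      using ends by (auto simp: U_def intro: gr0I)
    then show "(rot 10 ^^ 11) v = v"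
      using funpow_rot_id[of v 10] by (simp del: funpow.simps)
    \<comment> \<open>An even fixed point satisfies \<open>v div 2 = v\<close>, an odd one
      \<open>m + 1024 = 2 * m + 1\<close>; the solutions 0 and 2047 both lie in
      \<open>X\<close>.\<close>
    have "rot 10 v \<noteq> v"
    proof (cases "even v")
      case True
      then show ?thesis using v(2) by (simp add: rot_def)
    next
      case False
      then obtain m where "v = 2 * m + 1" by (rule oddE)
      then show ?thesis using v(3) by (simp add: rot_def)
    qed
    then show "\<not> (v \<in> T \<and> rot 10 v \<in> T)"
      using adj_rot[of 10 v] v(1) indep by auto
  qed (simp add: U_def)
  \<comment> \<open>Since \<open>1936 = 11 * 176\<close>, this is five words for each of the 176
    remaining rotation cycles.\<close>
  then have "card (T \<inter> U) \<le> 880"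
    using cardU by simp
  moreover have "card (T \<inter> X) \<le> 51"
    unfolding X_def sum_short_cycles[symmetric]
    using short_cycles_closed_walks indep by (intro card_Int_concat_le[of _ "adj 10"]) auto
  moreover have "T = T \<inter> U \<union> T \<inter> X"
    using assms(1) by (auto simp: U_def)
  ultimately show ?thesis
    using card_Un_le[of "T \<inter> U" "T \<inter> X"] by simp
qed

section \<open>An independent set of cardinality 931\<close>

text \<open>Intervals keep the verification small: comparing the end points of 44 blocks replaces
  comparing 931 words pairwise.\<close>

definition blocks :: "(nat \<times> nat) list" where
  "blocks =
    [(2, 2), (6, 10), (22, 42), (86, 138), (145, 146), (149, 170), (278, 289), (294, 297),
     (342, 426), (436, 458), (469, 490), (501, 523), (532, 554), (581, 587), (596, 683),
     (854, 871), (918, 937), (982, 1001), (1048, 1063), (1110, 1161), (1176, 1191),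
     (1368, 1450), (1460, 1482), (1493, 1514), (1525, 1547), (1556, 1578), (1605, 1611),
     (1620, 1707), (1750, 1753), (1766, 1769), (1782, 1785), (1798, 1801), (1814, 1825),
     (1830, 1833), (1878, 1898), (1901, 1906), (1909, 1914), (1917, 1922), (1925, 1930),
     (1937, 1938), (1941, 1962), (2006, 2026), (2038, 2042), (2046, 2046)]"

text \<open>The word 0 is kept apart from the blocks because its loop would violate
  \<open>blocks_separated\<close> below.\<close>

definition T931 :: "nat set" where
  "T931 = insert 0 (\<Union>(a, b)\<in>set blocks. {a..b})"

lemma card_UN_intervals:
  fixes xs :: "(nat \<times> nat) list"
  assumes "sorted_wrt (\<lambda>(a, b) (c, d). b < c) xs"
  shows "card (\<Union>(a, b)\<in>set xs. {a..b}) = (\<Sum>(a, b)\<leftarrow>xs. Suc b - a)"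
  using assms
proof (induction xs)
  case (Cons x xs)
  obtain a b where x: "x = (a, b)" by fastforce
  have "{a..b} \<inter> (\<Union>(c, d)\<in>set xs. {c..d}) = {}"
    using Cons.prems by (fastforce simp: x)
  then show ?case
    using Cons by (simp add: x card_Un_disjoint split_beta)
qed simp

text \<open>Where the quotient by \<open>m\<close> is constant, reduction modulo \<open>m\<close>
  subtracts a constant and is therefore monotone.\<close>

lemma mod_between:
  fixes a u b m :: nat
  assumes "a \<le> u" "u \<le> b" "a div m = b div m"
  shows "a mod m \<le> u mod m \<and> u mod m \<le> b mod m"
proof -
  have "u div m = a div m"
    using assms div_le_mono[of a u m] div_le_mono[of u b m] by simp
  then show ?thesis
    using assms by (simp add: modulo_nat_def diff_le_mono)
qed

text \<open>No block crosses 1024, so \<open>mod_between\<close> applies with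
  \<open>m = 1024\<close>. The lower bounds also keep out 1 and 1024, the two neighbours of
  0.\<close>

lemma blocks_bounds: "\<forall>(a, b)\<in>set blocks. 1 < a \<and> b < 2047 \<and> a div 1024 = b div 1024 \<and> 0 < a mod 1024"
  unfolding blocks_def by simp

lemma blocks_sorted: "sorted_wrt (\<lambda>(a, b) (c, d). b < c) blocks"
  unfolding blocks_def by simp

lemma blocks_sum: "(\<Sum>(a, b)\<leftarrow>blocks. Suc b - a) = 930"
  unfolding blocks_def by simp

text \<open>Halving the first block and reducing the second modulo 1024 land in disjoint ranges, so
  no arc joins them. Taking the same block twice excludes arcs inside it.\<close>

lemma blocks_separated:
  "\<forall>(a, b)\<in>set blocks. \<forall>(c, d)\<in>set blocks. b div 2 < c mod 1024 \<or> d mod 1024 < a div 2"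
  unfolding blocks_def by simp

lemma card_T931: "card T931 = 931"
proof -
  let ?B = "\<Union>(a, b)\<in>set blocks. {a..b}"
  have "0 \<notin> ?B"
    using blocks_bounds by fastforce
  moreover have "finite ?B" by auto
  moreover have "card ?B = 930"
    using card_UN_intervals[OF blocks_sorted] blocks_sum by argo
  ultimately show ?thesis
    unfolding T931_def by (subst card_insert_disjoint) simp_all
qed

lemma T931_less: "v \<in> T931 \<Longrightarrow> v < 2047"
  using blocks_bounds by (fastforce simp: T931_def)

lemma T931_independent:
  assumes "u \<in> T931" "v \<in> T931"
  shows "\<not> adj 10 u v"
proof -
  have block: "\<exists>(a, b)\<in>set blocks. a \<le> u \<and> u \<le> b" if "u \<in> T931" "u \<noteq> 0" for u
    using that by (fastforce simp: T931_def)
  have pos: "0 < u div 2" "0 < u mod 1024" if "u \<in> T931" "u \<noteq> 0" for u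
  proof -
    from block[OF that] obtain a b where ab: "(a, b) \<in> set blocks" "a \<le> u" "u \<le> b" by auto
    then have "1 < a" "a div 1024 = b div 1024" "0 < a mod 1024" using blocks_bounds by auto
    then show "0 < u div 2" "0 < u mod 1024"
      using ab(2) mod_between[OF ab(2,3), of 1024] by auto
  qed
  \<comment> \<open>Proved for all \<open>u\<close> and \<open>v\<close>, since \<open>adj\<close>
    involves both directions.\<close>
  have "u div 2 \<noteq> v mod 1024" if uv: "u \<in> T931" "v \<in> T931" "u \<noteq> v" for u v
  proof (cases "u = 0 \<or> v = 0")
    \<comment> \<open>Exactly one of the two words is 0; its side of the equation is 0 and the other
      side is positive.\<close>
    case True
    then show ?thesis using pos[OF uv(1)] pos[OF uv(2)] uv(3) by auto
  next
    case False
    from block[of u] uv False obtain a b where ab: "(a, b) \<in> set blocks" "a \<le> u" "u \<le> b" by auto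
    from block[of v] uv False obtain c d where cd: "(c, d) \<in> set blocks" "c \<le> v" "v \<le> d" by auto
    have "c div 1024 = d div 1024" using blocks_bounds cd by auto
    then have "c mod 1024 \<le> v mod 1024" "v mod 1024 \<le> d mod 1024"
      using mod_between[OF cd(2,3)] by auto
    moreover have "a div 2 \<le> u div 2" "u div 2 \<le> b div 2"
      using ab(2,3) by (simp_all add: div_le_mono)
    moreover have "b div 2 < c mod 1024 \<or> d mod 1024 < a div 2"
      using blocks_separated ab cd by auto
    ultimately show ?thesis by linarith
  qed
  then show ?thesis using assms by (auto simp: adj_def)
qed

section \<open>Transfer of both bounds from codes to words\<close>

theorem theorem4p7:
  shows "de_Bruijn_alpha 11 2 = 931 \<and>
    (\<exists>S. independent_set (underlying_simple_graph (de_Bruijn 11 2)) S \<and> card S = 931 \<and>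
         replicate 11 0 \<in> S \<and> replicate 11 1 \<notin> S)"
proof -
  let ?G = "underlying_simple_graph (de_Bruijn 11 2)"
  have verts: "pverts ?G = words 11 2"
    by (simp add: underlying_simple_graph_def de_Bruijn_def)
  have adj: "(u, v) \<in> parcs ?G \<longleftrightarrow> adj 10 (code u) (code v)"
    if "u \<in> words 11 2" "v \<in> words 11 2" for u v
    using parcs_de_Bruijn_iff_adj[of u 10 v] that by simp
  have bij: "bij_betw code (words 11 2) {..<2048}"
    using bij_betw_code[of 11] by simp
  have le: "card S \<le> 931" if "independent_set ?G S" for S
  proof -
    from that have S: "S \<subseteq> words 11 2" by (simp add: independent_set_def verts)
    then have "card S = card (code ` S)"
      using inj_on_subset[OF inj_on_code] by (simp add: card_image)
    also have "\<dots> \<le> 931"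
    proof (rule card_independent_le)
      show "code ` S \<subseteq> {..<2048}" using S bij by (auto dest: bij_betwE)
      show "\<not> adj 10 u v" if uv: "u \<in> code ` S" "v \<in> code ` S" for u v
      proof -
        from uv obtain x y where "x \<in> S" "y \<in> S" "u = code x" "v = code y" by blast
        then show ?thesis
          using \<open>independent_set ?G S\<close> S adj[of x y] unfolding independent_set_def by blast
      qed
    qed
    finally show ?thesis .
  qed
  define S where "S = {w \<in> words 11 2. code w \<in> T931}"
  have indep: "independent_set ?G S"
    using adj T931_independent by (auto simp: independent_set_def verts S_def)
  \<comment> \<open>All of \<open>T931\<close> consists of codes, so passing to the preimage
    \<open>S\<close> loses no element.\<close>
  have "T931 \<subseteq> code ` words 11 2"
    using T931_less unfolding bij_betw_imp_surj_on[OF bij] by fastforce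
  then have "code ` S = T931"
    unfolding S_def by blast
  then have card: "card S = 931"
    using card_image[OF inj_on_subset[OF inj_on_code], of S 11] by (simp add: S_def card_T931)
  have "code (replicate 11 0) = 0" "code (replicate 11 1) = 2047"
    using code_replicate_0[of 11] code_replicate_1[of 11] by simp_all
  moreover have "replicate 11 0 \<in> words 11 2"
    by (simp add: words_def)
  moreover have "0 \<in> T931" "2047 \<notin> T931"
    using T931_less[of 2047] by (auto simp: T931_def)
  ultimately have ends: "replicate 11 0 \<in> S" "replicate 11 1 \<notin> S"
    unfolding S_def by simp_all
  have "{S. independent_set ?G S} \<subseteq> Pow (words 11 2)"
    by (auto simp: independent_set_def verts)
  then have "finite {S. independent_set ?G S}"
    by (rule finite_subset) (simp add: finite_words)
  then have "Max (card ` {S. independent_set ?G S}) = 931"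
    using le indep card by (intro Max_eqI) auto
  then show ?thesis
    using indep card ends by (auto simp: de_Bruijn_alpha_def independence_number_def)
qed

end
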